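(* Let $X,Y$ be real vector spaces, let $F\colon X\rightrightarrows Y$ be a convex set-valued mapping, let $\varphi\colon X\times Y\to(-\infty,\infty]$ be a convex function, and let $$\mu(x):=\inf\{\varphi(x,y)\mid y\in F(x)\},\quad x\in X.$$ Suppose that $\mathrm{core}(\mathrm{gph}(F))\neq\emptyset$, $\mathrm{core}(\mathrm{epi}(\varphi))\neq\emptyset$, and $\mu(x)>-\infty$ for all $x\in X$. Given $\bar{x}\in\mathrm{dom}(\mu)$, consider the set $$S(\bar{x}):=\{\bar{y}\in F(\bar{x})\mid\mu(\bar{x})=\varphi(\bar{x},\bar{y})\},$$ which is assumed to be nonempty. Then for any $\bar{y}\in S(\bar{x})$ we have $$\partial\mu(\bar{x})=\bigcup_{(f,g)\in\partial\varphi(\bar{x},\bar{y})}\big[f+D^*F(\bar{x},\bar{y})(g)\big]$$ provided that $$\mathrm{core}(\mathrm{dom}(\varphi))\cap\mathrm{core}(\mathrm{gph}(F))\neq\emptyset.$$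
   Context: All vector spaces are real and carry no topology. $X'$ denotes the algebraic dual of $X$ (all linear functions $X\to\mathbb{R}$); $(X\times Y)'$ is identified with $X'\times Y'$ via $(f,g)(x,y)=f(x)+g(y)$. For a subset $\Omega$ of a vector space $Z$, $\mathrm{core}(\Omega):=\{x\in\Omega\mid \forall v\in Z\ \exists\delta>0\ \forall t\in\mathbb{R}\text{ with }|t|<\delta:\ x+tv\in\Omega\}$. For a function $\varphi\colon Z\to(-\infty,\infty]$: $\mathrm{dom}(\varphi):=\{z\in Z\mid\varphi(z)<\infty\}$, $\mathrm{epi}(\varphi):=\{(z,\alpha)\in Z\times\mathbb{R}\mid\alpha\ge\varphi(z)\}$, and, for $\varphi$ convex and $\bar{z}\in\mathrm{dom}(\varphi)$, $\partial\varphi(\bar{z}):=\{f\in Z'\mid\varphi(z)\ge\varphi(\bar{z})+f(z-\bar{z})\ \forall z\in Z\}$. The convention $\inf\emptyset=\infty$ is used; $\mu$ is convex when $\varphi$ and $F$ are. For a nonempty convex $\Omega\subset Z$ and $\bar{z}\in\Omega$, $N(\bar{z};\Omega):=\{f\in Z'\mid f(z-\bar{z})\le 0\ \forall z\in\Omega\}$. A set-valued mapping $F\colon X\rightrightarrows Y$ has (possibly empty) values $F(x)\subset Y$, $\mathrm{gph}(F):=\{(x,y)\in X\times Y\mid y\in F(x)\}$, and $F$ is convex if $\mathrm{gph}(F)$ is convex. The coderivative of a convex $F$ at $(\bar{x},\bar{y})\in\mathrm{gph}(F)$ is $D^*F(\bar{x},\bar{y})\colon Y'\rightrightarrows X'$,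 $D^*F(\bar{x},\bar{y})(g):=\{f\in X'\mid(f,-g)\in N((\bar{x},\bar{y});\mathrm{gph}(F))\}$. *)

theory Defs
  imports "HOL-Analysis.Analysis"
begin

definition algebraic_dual :: "('a::real_vector \<Rightarrow> real) set" where
  "algebraic_dual = {f. linear f}"

definition core :: "'a::real_vector set \<Rightarrow> 'a set" where
  "core S = {x \<in> S. \<forall>v. \<exists>\<delta>>0. \<forall>t::real. \<bar>t\<bar> < \<delta> \<longrightarrow> x + t *\<^sub>R v \<in> S}"

text \<open>
  A function into the interval from (excluded) minus infinity to plus infinity is modelled as an
  \<open>ereal\<close>-valued function that never takes the value \<open>-\<infinity>\<close>.
\<close>

definition never_minf :: "('a \<Rightarrow> ereal) \<Rightarrow> bool" where
  "never_minf \<phi> \<longleftrightarrow> (\<forall>z. \<phi> z \<noteq> -\<infinity>)"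

text \<open>
  As \<open>t\<close> is strictly between 0 and 1, the right-hand side never involves \<open>0 * \<infinity>\<close>; for functions
  that never take the value \<open>-\<infinity>\<close> it never involves \<open>\<infinity> + -\<infinity>\<close> either.
\<close>

definition ereal_convex :: "('a::real_vector \<Rightarrow> ereal) \<Rightarrow> bool" where
  "ereal_convex \<phi> \<longleftrightarrow>
    (\<forall>x y. \<forall>t::real. 0 < t \<and> t < 1 \<longrightarrow>
      \<phi> (t *\<^sub>R x + (1 - t) *\<^sub>R y) \<le> ereal t * \<phi> x + ereal (1 - t) * \<phi> y)"

definition eff_dom :: "('a \<Rightarrow> ereal) \<Rightarrow> 'a set" where
  "eff_dom \<phi> = {z. \<phi> z < \<infinity>}"

definition epi :: "('a \<Rightarrow> ereal) \<Rightarrow> ('a \<times> real) set" where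
  "epi \<phi> = {(z, \<alpha>). \<phi> z \<le> ereal \<alpha>}"

text \<open>The next two notions are meant only for \<open>zbar \<in> eff_dom \<phi>\<close> and \<open>zbar \<in> S\<close>, respectively.\<close>

definition subdifferential :: "('a::real_vector \<Rightarrow> ereal) \<Rightarrow> 'a \<Rightarrow> ('a \<Rightarrow> real) set" where
  "subdifferential \<phi> zbar =
    {f \<in> algebraic_dual. \<forall>z. \<phi> z \<ge> \<phi> zbar + ereal (f (z - zbar))}"

definition normal_cone :: "'a::real_vector \<Rightarrow> 'a set \<Rightarrow> ('a \<Rightarrow> real) set" where
  "normal_cone zbar S = {f \<in> algebraic_dual. \<forall>z\<in>S. f (z - zbar) \<le> 0}"

text \<open>The identification of pairs of functionals with functionals on the product space.\<close>

definition dual_pair :: "('a \<Rightarrow> real) \<Rightarrow> ('b \<Rightarrow> real) \<Rightarrow> 'a \<times> 'b \<Rightarrow> real" where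
  "dual_pair f g = (\<lambda>(x, y). f x + g y)"

lemma bij_betw_dual_pair:
  "bij_betw (\<lambda>(f, g). dual_pair f g)
    ((algebraic_dual :: ('a::real_vector \<Rightarrow> real) set) \<times> (algebraic_dual :: ('b::real_vector \<Rightarrow> real) set))
    algebraic_dual"
proof (rule bij_betw_byWitness[where f' = "\<lambda>h. (\<lambda>x. h (x, 0), \<lambda>y. h (0, y))"])
  show "\<forall>p\<in>(algebraic_dual :: ('a \<Rightarrow> real) set) \<times> (algebraic_dual :: ('b \<Rightarrow> real) set).
      (\<lambda>h. (\<lambda>x. h (x, 0), \<lambda>y. h (0, y))) ((\<lambda>(f, g). dual_pair f g) p) = p"
    by (auto simp: algebraic_dual_def dual_pair_def linear_0)
  show "\<forall>h\<in>(algebraic_dual :: ('a \<times> 'b \<Rightarrow> real) set).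
      (\<lambda>(f, g). dual_pair f g) (\<lambda>x. h (x, 0), \<lambda>y. h (0, y)) = h"
    by (auto simp: algebraic_dual_def dual_pair_def fun_eq_iff simp flip: linear_add)
  show "(\<lambda>(f, g). dual_pair f g) `
      ((algebraic_dual :: ('a \<Rightarrow> real) set) \<times> (algebraic_dual :: ('b \<Rightarrow> real) set)) \<subseteq> algebraic_dual"
    by (auto simp: algebraic_dual_def dual_pair_def linear_iff algebra_simps)
  show "(\<lambda>h. (\<lambda>x. h (x, 0), \<lambda>y. h (0, y))) ` (algebraic_dual :: ('a \<times> 'b \<Rightarrow> real) set)
      \<subseteq> algebraic_dual \<times> algebraic_dual"
  proof (clarsimp simp: algebraic_dual_def)
    fix h :: "'a \<times> 'b \<Rightarrow> real" assume h: "linear h"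
    have "linear (\<lambda>x::'a. (x, 0::'b))" "linear (\<lambda>y::'b. (0::'a, y))"
      by (auto simp: linear_iff)
    from this[THEN linear_compose, OF h]
    show "linear (\<lambda>x. h (x, 0)) \<and> linear (\<lambda>y. h (0, y))"
      by (simp add: o_def)
  qed
qed

definition gph :: "('a \<Rightarrow> 'b set) \<Rightarrow> ('a \<times> 'b) set" where
  "gph F = {(x, y). y \<in> F x}"

definition convex_map :: "('a::real_vector \<Rightarrow> 'b::real_vector set) \<Rightarrow> bool" where
  "convex_map F \<longleftrightarrow> convex (gph F)"

definition coderivative ::
  "('a::real_vector \<Rightarrow> 'b::real_vector set) \<Rightarrow> 'a \<times> 'b \<Rightarrow> ('b \<Rightarrow> real) \<Rightarrow> ('a \<Rightarrow> real) set" where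
  "coderivative F zbar g =
    {f \<in> algebraic_dual. dual_pair f (\<lambda>y. - g y) \<in> normal_cone zbar (gph F)}"

text \<open>The infimum over an empty value of \<open>F\<close> is \<open>\<infinity>\<close>, the top element of \<open>ereal\<close>.\<close>

definition optimal_value :: "('a \<times> 'b \<Rightarrow> ereal) \<Rightarrow> ('a \<Rightarrow> 'b set) \<Rightarrow> 'a \<Rightarrow> ereal" where
  "optimal_value \<phi> F x = (INF y\<in>F x. \<phi> (x, y))"

definition solution_set :: "('a \<times> 'b \<Rightarrow> ereal) \<Rightarrow> ('a \<Rightarrow> 'b set) \<Rightarrow> 'a \<Rightarrow> 'b set" where
  "solution_set \<phi> F x = {y \<in> F x. optimal_value \<phi> F x = \<phi> (x, y)}"

end

theory Submission
  imports Defs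
begin

text \<open>
  Let \<open>h\<close> be a subgradient of the optimal value function at \<open>xbar\<close> and \<open>c = \<phi> (xbar, ybar)\<close>. On the
  graph of \<open>F\<close>, the function \<open>\<phi>\<close> lies above the affine function \<open>a (x, y) = c + h (x - xbar)\<close>. The
  convex set \<open>epi \<phi> - {(z, a z) | z \<in> gph F}\<close> generates a convex cone whose lower boundary is a
  finite sublinear function, because the qualification condition makes the cone project onto the
  whole space. A linear minorant \<open>L\<close> of this function satisfies \<open>L (z' - z) \<le> \<phi> z' - a z\<close> for all
  \<open>z'\<close> and all \<open>z \<in> gph F\<close>; taking \<open>z = (xbar, ybar)\<close> shows that \<open>L\<close> is a subgradient of \<open>\<phi>\<close>, and
  taking \<open>z' = (xbar, ybar)\<close> gives the normal cone condition of the coderivative.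
\<close>

section \<open>Sublinear functions and their linear minorants\<close>

definition sublinear :: "('a::real_vector \<Rightarrow> real) \<Rightarrow> bool" where
  "sublinear p \<longleftrightarrow> (\<forall>x y. p (x + y) \<le> p x + p y) \<and> (\<forall>a>0. \<forall>x. p (a *\<^sub>R x) = a * p x)"

lemma sublinear_add: "sublinear p \<Longrightarrow> p (x + y) \<le> p x + p y"
  by (simp add: sublinear_def)

lemma sublinear_scale: "sublinear p \<Longrightarrow> a > 0 \<Longrightarrow> p (a *\<^sub>R x) = a * p x"
  by (simp add: sublinear_def)

lemma sublinear_0: "sublinear p \<Longrightarrow> p 0 = 0"
  using sublinear_scale[of p 2 0] by simp

lemma sublinear_ge_minus: "sublinear p \<Longrightarrow> - p (- x) \<le> p x"
  using sublinear_add[of p x "- x"] sublinear_0[of p] by simp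

text \<open>Additivity and \<open>p 0 = 0\<close> give \<open>p (- x) = - p x\<close>, which extends
  homogeneity from positive factors to all real ones.\<close>

lemma linear_if_sublinear_additive:
  assumes p: "sublinear p" and add: "\<And>x y. p (x + y) = p x + p y"
  shows "linear p"
proof (rule linearI)
  fix a x
  have pos: "p (b *\<^sub>R x) = b * p x" if "b \<ge> 0" for b
    using that sublinear_scale[OF p] sublinear_0[OF p] by (cases "b = 0") auto
  have "p (a *\<^sub>R x) + p ((- a) *\<^sub>R x) = 0"
    using add[of "a *\<^sub>R x" "(- a) *\<^sub>R x"] sublinear_0[OF p] by simp
  then show "p (a *\<^sub>R x) = a *\<^sub>R p x"
    using pos[of a] pos[of "- a"] by (cases "a \<ge> 0") auto
qed (rule add)

text \<open>This supplies the lower bounds of chains for Zorn's lemma. An infimum of sublinear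
  functions need not be subadditive; in a chain, two members \<open>p\<close> and \<open>p'\<close>
  can be replaced by the smaller one, whose subadditivity then does the work.\<close>

lemma sublinear_INF_chain:
  fixes C :: "('a::real_vector \<Rightarrow> real) set"
  assumes "C \<noteq> {}" and sub: "\<And>p. p \<in> C \<Longrightarrow> sublinear p"
    and chain: "\<And>p p'. p \<in> C \<Longrightarrow> p' \<in> C \<Longrightarrow> p \<le> p' \<or> p' \<le> p"
    and bdd: "\<And>x. bdd_below ((\<lambda>p. p x) ` C)"
  shows "sublinear (\<lambda>x. INF p\<in>C. p x)"
  unfolding sublinear_def
proof (intro conjI allI impI)
  fix x y
  have *: "(INF p\<in>C. p (x + y)) \<le> p x + p' y" if "p \<in> C" "p' \<in> C" for p p'
  proof -
    from chain[OF that] obtain r where r: "r \<in> C" "r \<le> p" "r \<le> p'"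
      using \<open>p \<in> C\<close> \<open>p' \<in> C\<close> by (metis order_refl)
    have "(INF p\<in>C. p (x + y)) \<le> r (x + y)"
      using r bdd by (intro cINF_lower)
    also have "\<dots> \<le> r x + r y"
      using r sub sublinear_add by blast
    also have "\<dots> \<le> p x + p' y"
      using r by (intro add_mono) (auto simp: le_fun_def)
    finally show ?thesis .
  qed
  \<comment> \<open>The bound holds for independent \<open>p\<close> and \<open>p'\<close>, so the
    two infima can be taken one after the other.\<close>
  have "(INF p\<in>C. p (x + y)) - p x \<le> (INF p\<in>C. p y)" if "p \<in> C" for p
    using *[OF that] \<open>C \<noteq> {}\<close>
    by (intro cINF_greatest) (auto simp: diff_le_eq add.commute)
  then have "(INF p\<in>C. p (x + y)) - (INF p\<in>C. p y) \<le> (INF p\<in>C. p x)"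
    using \<open>C \<noteq> {}\<close> by (intro cINF_greatest) (auto simp: diff_le_eq algebra_simps)
  then show "(INF p\<in>C. p (x + y)) \<le> (INF p\<in>C. p x) + (INF p\<in>C. p y)"
    by simp
next
  fix a :: real and x :: 'a
  assume a: "a > 0"
  \<comment> \<open>One inequality for all positive factors suffices: the reverse one is the case of
    \<open>1 / a\<close> at \<open>a *\<^sub>R x\<close>.\<close>
  have le: "b * (INF p\<in>C. p y) \<le> (INF p\<in>C. p (b *\<^sub>R y))" if "b > 0" for b y
    using \<open>C \<noteq> {}\<close> bdd that sub
    by (intro cINF_greatest) (auto simp: sublinear_scale intro!: mult_left_mono cINF_lower)
  show "(INF p\<in>C. p (a *\<^sub>R x)) = a * (INF p\<in>C. p x)"
    using le[of a x] le[of "1 / a" "a *\<^sub>R x"] a by (auto simp: field_simps intro!: antisym)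
qed

text \<open>If \<open>p\<close> is minimal, then \<open>q\<close> coincides with \<open>p\<close>,
  and \<open>q x \<le> p (x + v) - p v\<close> becomes the reverse of subadditivity. The infimum
  runs over a whole ray to make \<open>q\<close> sublinear: the parameters \<open>t\<close> add
  under sums and rescale under positive factors.\<close>

lemma sublinear_INF_ray:
  fixes p :: "'a::real_vector \<Rightarrow> real" and v :: 'a
  assumes p: "sublinear p"
  defines "q \<equiv> \<lambda>x. INF t\<in>{0..}. p (x + t *\<^sub>R v) - t * p v"
  shows "sublinear q" and "q x \<le> p (x + v) - p v" and "q x \<le> p x"
proof -
  have scale: "p (t *\<^sub>R x) = t * p x" if "t \<ge> 0" for t x
    using that sublinear_scale[OF p] sublinear_0[OF p] by (cases "t = 0") auto
  have bdd: "bdd_below ((\<lambda>t. p (x + t *\<^sub>R v) - t * p v) ` {0..})" for x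
  \<comment> \<open>The bound rests on \<open>t * p v = p (t *\<^sub>R v) \<le> p (x + t *\<^sub>R
    v) + p (- x)\<close>.\<close>
  proof (rule bdd_belowI2[where m = "- p (- x)"])
    fix t :: real assume "t \<in> {0..}"
    then show "- p (- x) \<le> p (x + t *\<^sub>R v) - t * p v"
      using sublinear_add[OF p, of "x + t *\<^sub>R v" "- x"] scale[of t v] by simp
  qed
  have low: "q x \<le> p (x + t *\<^sub>R v) - t * p v" if "t \<ge> 0" for x t
    unfolding q_def using that bdd by (intro cINF_lower) auto
  have great: "m \<le> q x" if "\<And>t. t \<ge> 0 \<Longrightarrow> m \<le> p (x + t *\<^sub>R v) - t * p v" for m x
    unfolding q_def using that by (intro cINF_greatest) auto
  show "q x \<le> p (x + v) - p v" "q x \<le> p x"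
    using low[of 1 x] low[of 0 x] by auto
  show "sublinear q"
    unfolding sublinear_def
  proof (intro conjI allI impI)
    fix x y
    have *: "q (x + y) \<le> (p (x + s *\<^sub>R v) - s * p v) + (p (y + t *\<^sub>R v) - t * p v)"
      if "s \<ge> 0" "t \<ge> 0" for s t
      using low[of "s + t" "x + y"] that sublinear_add[OF p, of "x + s *\<^sub>R v" "y + t *\<^sub>R v"]
      by (simp add: algebra_simps)
    have "q (x + y) - (p (x + s *\<^sub>R v) - s * p v) \<le> q y" if "s \<ge> 0" for s
      using *[OF that] by (intro great) (simp add: algebra_simps)
    then have "q (x + y) - q y \<le> q x"
      by (intro great) (simp add: algebra_simps)
    then show "q (x + y) \<le> q x + q y"
      by simp
  next
    fix a :: real and x
    assume a: "a > 0"
    have le: "b * q y \<le> q (b *\<^sub>R y)" if "b > 0" for b y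
    proof (rule great)
      fix t :: real assume "t \<ge> 0"
      then have "b * q y \<le> b * (p (y + (t / b) *\<^sub>R v) - t / b * p v)"
        using that by (intro mult_left_mono low) auto
      also have "\<dots> = p (b *\<^sub>R y + t *\<^sub>R v) - t * p v"
        using that sublinear_scale[OF p, of b "y + (t / b) *\<^sub>R v"]
        by (simp add: algebra_simps)
      finally show "b * q y \<le> p (b *\<^sub>R y + t *\<^sub>R v) - t * p v" .
    qed
    show "q (a *\<^sub>R x) = a * q x"
      using le[of a x] le[of "1 / a" "a *\<^sub>R x"] a by (auto simp: field_simps intro!: antisym)
  qed
qed

text \<open>Minimal sublinear functions are additive, so no extension from subspaces is needed.\<close>

theorem sublinear_imp_linear_minorant:
  fixes q :: "'a::real_vector \<Rightarrow> real"
  assumes q: "sublinear q"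
  obtains L where "linear L" "\<And>x. L x \<le> q x"
proof -
  define A where "A = {p. sublinear p \<and> p \<le> q}"
  \<comment> \<open>Zorn's lemma is applied to the reversed pointwise order, so its maximal element
    is a minimal sublinear function below \<open>q\<close>.\<close>
  have "\<exists>m\<in>A. \<forall>p\<in>A. p \<le> m \<longrightarrow> p = m"
  proof (rule predicate_Zorn)
    show "partial_order_on A (relation_of (\<lambda>p p'. p' \<le> p) A)"
      by (rule partial_order_on_relation_ofI) auto
  next
    fix C assume "C \<in> Chains (relation_of (\<lambda>p p'. p' \<le> p) A)"
    then have CA: "C \<subseteq> A" and chain: "\<And>p p'. p \<in> C \<Longrightarrow> p' \<in> C \<Longrightarrow> p \<le> p' \<or> p' \<le> p"
      by (auto simp: Chains_def relation_of_def)
    show "\<exists>u\<in>A. \<forall>p\<in>C. u \<le> p"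
    proof (cases "C = {}")
      case True
      then show ?thesis
        using q by (auto simp: A_def)
    next
      case False
      \<comment> \<open>Every member satisfies \<open>- q (- x) \<le> - p (- x) \<le> p x\<close>, a
        bound independent of \<open>p\<close>.\<close>
      have bdd: "bdd_below ((\<lambda>p. p x) ` C)" for x
      proof (rule bdd_belowI2[where m = "- q (- x)"])
        fix p assume "p \<in> C"
        then have "sublinear p" "p (- x) \<le> q (- x)"
          using CA by (auto simp: A_def le_fun_def)
        then show "- q (- x) \<le> p x"
          using sublinear_ge_minus[of p x] by linarith
      qed
      let ?u = "\<lambda>x. INF p\<in>C. p x"
      have le: "?u \<le> p" if "p \<in> C" for p
        using that bdd by (auto simp: le_fun_def intro: cINF_lower)
      moreover have "sublinear ?u"
        using False CA chain bdd by (intro sublinear_INF_chain) (auto simp: A_def)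
      moreover have "?u \<le> q"
        using False le CA unfolding A_def by (blast intro: order_trans)
      ultimately show ?thesis
        by (auto simp: A_def)
    qed
  qed
  then obtain m where m: "sublinear m" "m \<le> q"
    and min: "\<And>p. sublinear p \<Longrightarrow> p \<le> m \<Longrightarrow> p = m"
    unfolding A_def by (blast intro: order_trans)
  have "m (x + v) = m x + m v" for x v
  proof -
    have "(\<lambda>x. INF t\<in>{0..}. m (x + t *\<^sub>R v) - t * m v) = m"
      using sublinear_INF_ray[OF m(1), where v = v] by (intro min) (auto simp: le_fun_def)
    then have "m x \<le> m (x + v) - m v"
      using sublinear_INF_ray(2)[OF m(1), where v = v and x = x] by (simp add: fun_eq_iff)
    then show ?thesis
      using sublinear_add[OF m(1), of x v] by simp
  qed
  then have "linear m"
    using m(1) by (intro linear_if_sublinear_additive)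
  then show ?thesis
    using m(2) that by (auto simp: le_fun_def)
qed

section \<open>Linear functionals below convex cones and convex sets\<close>

text \<open>The lower boundary \<open>q\<close> of the cone is sublinear, and a linear minorant of
  it is the desired \<open>L\<close>. Finiteness of \<open>q\<close> comes from adding a point of
  the cone over \<open>- v\<close> to one over \<open>v\<close>: the sum lies over 0, where
  \<open>nonneg\<close> applies.\<close>

lemma linear_below_convex_cone:
  fixes C :: "('a::real_vector \<times> real) set"
  assumes add: "\<And>u v. u \<in> C \<Longrightarrow> v \<in> C \<Longrightarrow> u + v \<in> C"
    and scale: "\<And>a u. a > 0 \<Longrightarrow> u \<in> C \<Longrightarrow> a *\<^sub>R u \<in> C"
    and total: "\<And>v. \<exists>r. (v, r) \<in> C"
    and nonneg: "\<And>r. (0, r) \<in> C \<Longrightarrow> r \<ge> 0"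
  obtains L where "linear L" "\<And>v r. (v, r) \<in> C \<Longrightarrow> L v \<le> r"
proof -
  define q where "q v = Inf {r. (v, r) \<in> C}" for v
  have bdd: "bdd_below {r. (v, r) \<in> C}" for v
  proof -
    obtain s where "(- v, s) \<in> C"
      using total by blast
    then have "- s \<le> r" if "(v, r) \<in> C" for r
      using add[OF that \<open>(- v, s) \<in> C\<close>] nonneg[of "r + s"] by simp
    then show ?thesis
      by (intro bdd_belowI[where m = "- s"]) auto
  qed
  have low: "q v \<le> r" if "(v, r) \<in> C" for v r
    unfolding q_def using bdd that by (intro cInf_lower) auto
  have great: "m \<le> q v" if "\<And>r. (v, r) \<in> C \<Longrightarrow> m \<le> r" for m v
    unfolding q_def using total that by (intro cInf_greatest) auto
  have "sublinear q"
    unfolding sublinear_def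
  proof (intro conjI allI impI)
    fix x y
    have *: "q (x + y) \<le> r + s" if "(x, r) \<in> C" "(y, s) \<in> C" for r s
      using add[OF that] low by simp
    have "q (x + y) - r \<le> q y" if "(x, r) \<in> C" for r
      using *[OF that] by (intro great) (simp add: algebra_simps)
    then have "q (x + y) - q y \<le> q x"
      by (intro great) (simp add: algebra_simps)
    then show "q (x + y) \<le> q x + q y"
      by simp
  next
    fix a :: real and x
    assume a: "a > 0"
    have le: "b * q y \<le> q (b *\<^sub>R y)" if b: "b > 0" for b y
    proof (rule great)
      fix r assume "(b *\<^sub>R y, r) \<in> C"
      from scale[OF _ this, of "1 / b"] b have "(y, r / b) \<in> C"
        by simp
      then show "b * q y \<le> r"
        using low[of y "r / b"] b by (simp add: field_simps)
    qed
    show "q (a *\<^sub>R x) = a * q x"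
      using le[of a x] le[of "1 / a" "a *\<^sub>R x"] a by (auto simp: field_simps intro!: antisym)
  qed
  then obtain L where "linear L" "\<And>x. L x \<le> q x"
    using sublinear_imp_linear_minorant by blast
  then show ?thesis
    using that low order_trans by blast
qed

text \<open>The cone generated by \<open>K\<close> inherits \<open>nonneg\<close>, since positive
  scaling preserves both the base point 0 and the sign. The core condition says that
  \<open>K\<close> projects onto a set absorbing every direction, so the cone projects onto the
  whole space.\<close>

lemma linear_below_convex:
  fixes K :: "('a::real_vector \<times> real) set"
  assumes K: "convex K"
    and core: "0 \<in> core (fst ` K)"
    and nonneg: "\<And>r. (0, r) \<in> K \<Longrightarrow> r \<ge> 0"
  obtains L where "linear L" "\<And>v r. (v, r) \<in> K \<Longrightarrow> L v \<le> r"
proof -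
  define C where "C = {u. \<exists>t>0. \<exists>k\<in>K. u = t *\<^sub>R k}"
  obtain L where L: "linear L" "\<And>v r. (v, r) \<in> C \<Longrightarrow> L v \<le> r"
  proof (rule linear_below_convex_cone[of C])
    fix u v assume "u \<in> C" "v \<in> C"
    then obtain s t j k where st: "s > 0" "t > 0" and jk: "j \<in> K" "k \<in> K"
      and uv: "u = s *\<^sub>R j" "v = t *\<^sub>R k"
      unfolding C_def by blast
    \<comment> \<open>Normalising the weights turns a sum of two scaled points into a multiple of a
      convex combination.\<close>
    have "(s / (s + t)) *\<^sub>R j + (t / (s + t)) *\<^sub>R k \<in> K"
      using st jk by (intro convexD[OF K]) (auto simp flip: add_divide_distrib)
    moreover have "u + v = (s + t) *\<^sub>R ((s / (s + t)) *\<^sub>R j + (t / (s + t)) *\<^sub>R k)"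
      using st by (simp add: uv scaleR_add_right)
    ultimately show "u + v \<in> C"
      unfolding C_def using st by (blast intro: add_pos_pos)
  next
    fix a :: real and u assume "a > 0" "u \<in> C"
    then obtain t k where "t > 0" "k \<in> K" "u = t *\<^sub>R k"
      unfolding C_def by blast
    with \<open>a > 0\<close> have "a * t > 0" "a *\<^sub>R u = (a * t) *\<^sub>R k"
      by simp_all
    with \<open>k \<in> K\<close> show "a *\<^sub>R u \<in> C"
      unfolding C_def by blast
  next
    fix v
    obtain \<delta> where \<delta>: "\<delta> > 0" "\<And>t. \<bar>t\<bar> < \<delta> \<Longrightarrow> 0 + t *\<^sub>R v \<in> fst ` K"
      using core unfolding core_def by blast
    \<comment> \<open>Any positive number strictly below \<delta> would do; rescaling by its inverse
      leads back to \<open>v\<close>.\<close>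
    have "(\<delta> / 2) *\<^sub>R v \<in> fst ` K"
      using \<delta>(1) \<delta>(2)[of "\<delta> / 2"] by simp
    then obtain r where "((\<delta> / 2) *\<^sub>R v, r) \<in> K"
      by auto
    moreover have "(v, 2 / \<delta> * r) = (2 / \<delta>) *\<^sub>R ((\<delta> / 2) *\<^sub>R v, r)"
      using \<delta>(1) by simp
    ultimately show "\<exists>r. (v, r) \<in> C"
      unfolding C_def using \<delta>(1) by (metis (mono_tags, lifting) divide_pos_pos mem_Collect_eq zero_less_numeral)
  next
    fix r assume "(0, r) \<in> C"
    then show "r \<ge> 0"
      unfolding C_def using nonneg by (auto simp: zero_prod_def intro!: mult_nonneg_nonneg)
  qed blast
  show ?thesis
  proof (rule that[OF L(1)])
    fix v r assume "(v, r) \<in> K"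
    then have "(v, r) \<in> C"
      unfolding C_def by (auto intro!: exI[of _ 1])
    then show "L v \<le> r"
      by (rule L(2))
  qed
qed

section \<open>The subdifferential of the optimal value function\<close>

lemma convex_epi:
  assumes "ereal_convex \<phi>"
  shows "convex (epi \<phi>)"
  unfolding convex_alt
proof (intro ballI allI impI, clarify)
  fix x y and \<alpha> \<beta> u :: real
  assume \<alpha>: "(x, \<alpha>) \<in> epi \<phi>" and \<beta>: "(y, \<beta>) \<in> epi \<phi>" and u: "0 \<le> u" "u \<le> 1"
  show "(1 - u) *\<^sub>R (x, \<alpha>) + u *\<^sub>R (y, \<beta>) \<in> epi \<phi>"
  \<comment> \<open>The end points are treated apart because \<open>ereal_convex\<close> speaks only
    of weights strictly between 0 and 1.\<close>
  proof (cases "u = 0 \<or> u = 1")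
    case True
    then show ?thesis
      using \<alpha> \<beta> by auto
  next
    case False
    then have "\<phi> (u *\<^sub>R y + (1 - u) *\<^sub>R x) \<le> ereal u * \<phi> y + ereal (1 - u) * \<phi> x"
      using assms u unfolding ereal_convex_def by auto
    also have "\<dots> \<le> ereal u * ereal \<beta> + ereal (1 - u) * ereal \<alpha>"
      using \<alpha> \<beta> u by (intro add_mono ereal_mult_left_mono) (auto simp: epi_def)
    finally show ?thesis
      by (simp add: epi_def algebra_simps)
  qed
qed

text \<open>This is the inclusion that rests on separation. The separating functional splits into
  \<open>f\<close> and \<open>g\<close>, and \<open>k\<close> is the remainder of \<open>h\<close>
  after subtracting \<open>f\<close>.\<close>

lemma subdifferential_decompose:
  fixes F :: "'x::real_vector \<Rightarrow> 'y::real_vector set"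
    and \<phi> :: "'x \<times> 'y \<Rightarrow> ereal"
  assumes F: "convex_map F" and \<phi>: "ereal_convex \<phi>"
    and qual: "core (eff_dom \<phi>) \<inter> gph F \<noteq> {}"
    and ybar: "ybar \<in> solution_set \<phi> F xbar"
    and c: "\<phi> (xbar, ybar) = ereal c"
    and h: "h \<in> subdifferential (optimal_value \<phi> F) xbar"
  obtains f g k where "linear f" "linear g" "dual_pair f g \<in> subdifferential \<phi> (xbar, ybar)"
    "k \<in> coderivative F (xbar, ybar) g" "h = (\<lambda>x. f x + k x)"
proof -
  have mu: "optimal_value \<phi> F xbar = ereal c" and yF: "ybar \<in> F xbar"
    using ybar c by (auto simp: solution_set_def)
  have lin: "linear h"
    using h by (auto simp: subdifferential_def algebraic_dual_def)
  have ge: "ereal (c + h (x - xbar)) \<le> \<phi> (x, y)" if "y \<in> F x" for x y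
  proof -
    have "ereal (c + h (x - xbar)) \<le> optimal_value \<phi> F x"
      using h mu by (auto simp: subdifferential_def)
    also have "\<dots> \<le> \<phi> (x, y)"
      unfolding optimal_value_def using that by (rule INF_lower)
    finally show ?thesis .
  qed
  define T where "T = (\<lambda>z. (z, c + h (fst z - xbar))) ` gph F"
  define K where "K = (\<Union>u\<in>epi \<phi>. \<Union>v\<in>T. {u - v})"
  \<comment> \<open>\<open>T\<close> is the graph of an affine function over \<open>gph F\<close>,
    hence a translate of a linear image of a convex set.\<close>
  have "T = (+) (0, c - h xbar) ` (\<lambda>z. (z, h (fst z))) ` gph F"
    unfolding T_def image_image by (auto simp: linear_diff[OF lin])
  moreover have "linear (\<lambda>z :: 'x \<times> 'y. (z, h (fst z)))"
    using lin by (auto simp: linear_iff)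
  ultimately have "convex T"
    using F by (auto simp: convex_map_def intro!: convex_translation convex_linear_image)
  then have "convex K"
    unfolding K_def using convex_epi[OF \<phi>] by (intro convex_differences)
  \<comment> \<open>For \<open>z\<close> in both sets of \<open>qual\<close>, the projection of
    \<open>K\<close> contains \<open>eff_dom \<phi>\<close> shifted by \<open>- z\<close>, and 0 is
    a core point of that shifted set.\<close>
  moreover have "0 \<in> core (fst ` K)"
  proof -
    obtain z where z: "z \<in> core (eff_dom \<phi>)" "z \<in> gph F"
      using qual by blast
    have *: "w \<in> fst ` K" if w: "z + w \<in> eff_dom \<phi>" for w
    proof -
      obtain r where "\<phi> (z + w) \<le> ereal r"
        using w by (cases "\<phi> (z + w)") (auto simp: eff_dom_def)
      then have "(z + w, r) - (z, c + h (fst z - xbar)) \<in> K"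
        unfolding K_def T_def epi_def using z(2) by blast
      then show ?thesis
        by (force simp: image_iff)
    qed
    show ?thesis
      using z(1) *[of 0] unfolding core_def by (auto intro!: *) (metis *)
  qed
  \<comment> \<open>A point of \<open>K\<close> over 0 compares the epigraph and the affine function
    at the same point of \<open>gph F\<close>, where \<open>ge\<close> applies.\<close>
  moreover have "r \<ge> 0" if "(0, r) \<in> K" for r
  proof -
    from that obtain x y s where "\<phi> (x, y) \<le> ereal s" "y \<in> F x" "r = s - (c + h (x - xbar))"
      unfolding K_def T_def epi_def gph_def by (auto simp: zero_prod_def)
    then show ?thesis
      using ge[of y x] order_trans[of "ereal (c + h (x - xbar))" "\<phi> (x, y)" "ereal s"] by simp
  qed
  ultimately obtain L where L: "linear L" "\<And>v r. (v, r) \<in> K \<Longrightarrow> L v \<le> r"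
    using linear_below_convex by blast
  have sep: "L (z' - (x, y)) \<le> s - (c + h (x - xbar))"
    if "\<phi> z' \<le> ereal s" "y \<in> F x" for z' s x y
  proof (rule L(2))
    have "(z', s) - ((x, y), c + h (fst (x, y) - xbar)) \<in> K"
      unfolding K_def T_def epi_def gph_def using that by blast
    then show "(z' - (x, y), s - (c + h (x - xbar))) \<in> K"
      by simp
  qed
  define f where "f x = L (x, 0)" for x
  define g where "g y = L (0, y)" for y
  have fg: "L (x, y) = f x + g y" for x y
    unfolding f_def g_def using linear_add[OF L(1), of "(x, 0)" "(0, y)"] by simp
  have linf: "linear f" and ling: "linear g"
    unfolding f_def g_def linear_iff
    using linear_add[OF L(1), of "(_, 0)" "(_, 0)"] linear_add[OF L(1), of "(0, _)" "(0, _)"]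
      linear_cmul[OF L(1), of _ "(_, 0)"] linear_cmul[OF L(1), of _ "(0, _)"]
    by simp_all
  have dp: "dual_pair f g = L"
    by (auto simp: dual_pair_def fg)
  have "L \<in> subdifferential \<phi> (xbar, ybar)"
  proof -
    \<comment> \<open>Testing against all real upper bounds \<open>s\<close> of
      \<open>\<phi> z\<close> reduces the claim to \<open>sep\<close> and also covers the value
      \<infinity>, where no such \<open>s\<close> exists.\<close>
    have "ereal c + ereal (L (z - (xbar, ybar))) \<le> \<phi> z" for z
    proof (rule ereal_le_real)
      fix s assume "\<phi> z \<le> ereal s"
      from sep[OF this yF] show "ereal c + ereal (L (z - (xbar, ybar))) \<le> ereal s"
        using linear_0[OF lin] by simp
    qed
    then show ?thesis
      using L(1) c by (auto simp: subdifferential_def algebraic_dual_def)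
  qed
  moreover have "(\<lambda>x. h x - f x) \<in> coderivative F (xbar, ybar) g"
  proof -
    have "linear (dual_pair (\<lambda>x. h x - f x) (\<lambda>y. - g y))"
      using lin linf ling by (auto simp: dual_pair_def linear_iff algebra_simps)
    \<comment> \<open>With \<open>z' = (xbar, ybar)\<close> and \<open>s = c\<close> the constants
      in \<open>sep\<close> cancel, leaving
      \<open>h (x - xbar) \<le> f (x - xbar) + g (y - ybar)\<close>.\<close>
    moreover have "dual_pair (\<lambda>x. h x - f x) (\<lambda>y. - g y) ((x, y) - (xbar, ybar)) \<le> 0"
      if "y \<in> F x" for x y
      using sep[of "(xbar, ybar)" c y x] c that linear_diff[OF linf] linear_diff[OF ling]
      by (simp add: fg dual_pair_def)
    ultimately show ?thesis
      using linear_compose_sub[OF lin linf]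
      by (auto simp: coderivative_def normal_cone_def algebraic_dual_def gph_def)
  qed
  ultimately show ?thesis
    using that[of f g "\<lambda>x. h x - f x"] linf ling dp by simp
qed

text \<open>On the graph of \<open>F\<close> the normal cone inequality gives
  \<open>k (x - xbar) \<le> g (y - ybar)\<close>, so \<open>k\<close> can replace \<open>g\<close>
  in the subgradient inequality of \<phi>. The new lower bound no longer depends on \<open>y\<close>
  and passes to the infimum.\<close>

lemma subdifferential_compose:
  fixes F :: "'x::real_vector \<Rightarrow> 'y::real_vector set"
    and \<phi> :: "'x \<times> 'y \<Rightarrow> ereal"
  assumes ybar: "ybar \<in> solution_set \<phi> F xbar"
    and c: "\<phi> (xbar, ybar) = ereal c"
    and f: "linear f"
    and fg: "dual_pair f g \<in> subdifferential \<phi> (xbar, ybar)"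
    and k: "k \<in> coderivative F (xbar, ybar) g"
  shows "(\<lambda>x. f x + k x) \<in> subdifferential (optimal_value \<phi> F) xbar"
proof -
  have mu: "optimal_value \<phi> F xbar = ereal c"
    using ybar c by (auto simp: solution_set_def)
  have "ereal (c + (f (x - xbar) + k (x - xbar))) \<le> \<phi> (x, y)" if "y \<in> F x" for x y
  proof -
    have "k (x - xbar) - g (y - ybar) \<le> 0"
      using k that by (force simp: coderivative_def normal_cone_def gph_def dual_pair_def)
    then have "ereal (c + (f (x - xbar) + k (x - xbar))) \<le> ereal (c + (f (x - xbar) + g (y - ybar)))"
      by simp
    also have "\<dots> \<le> \<phi> (x, y)"
      using fg c by (auto simp: subdifferential_def dual_pair_def)
    finally show ?thesis .
  qed
  moreover have "linear (\<lambda>x. f x + k x)"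
    using f k by (intro linear_compose_add) (auto simp: coderivative_def algebraic_dual_def)
  ultimately show ?thesis
    using mu by (auto simp: subdifferential_def algebraic_dual_def optimal_value_def intro: INF_greatest)
qed

theorem theorem8p1:
  fixes F :: "'x::real_vector \<Rightarrow> 'y::real_vector set"
    and \<phi> :: "'x \<times> 'y \<Rightarrow> ereal"
    and xbar :: 'x and ybar :: 'y
  assumes "convex_map F"
    and "never_minf \<phi>"
    and "ereal_convex \<phi>"
    and "core (gph F) \<noteq> {}"
    and "core (epi \<phi>) \<noteq> {}"
    and "\<forall>x. optimal_value \<phi> F x > -\<infinity>"
    and "xbar \<in> eff_dom (optimal_value \<phi> F)"
    and "solution_set \<phi> F xbar \<noteq> {}"
    and "core (eff_dom \<phi>) \<inter> core (gph F) \<noteq> {}"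
    and "ybar \<in> solution_set \<phi> F xbar"
  shows "subdifferential (optimal_value \<phi> F) xbar =
    (\<Union>(f, g) \<in> {(f, g) \<in> algebraic_dual \<times> algebraic_dual.
                  dual_pair f g \<in> subdifferential \<phi> (xbar, ybar)}.
      (\<lambda>h x. f x + h x) ` coderivative F (xbar, ybar) g)"
proof -
  \<comment> \<open>As \<open>ybar\<close> is a solution, \<phi> takes at
    \<open>(xbar, ybar)\<close> the optimal value, which is below \<infinity> on the effective
    domain.\<close>
  have "\<phi> (xbar, ybar) < \<infinity>" "\<phi> (xbar, ybar) \<noteq> -\<infinity>"
    using assms(2,7,10) by (auto simp: eff_dom_def solution_set_def never_minf_def)
  then obtain c where c: "\<phi> (xbar, ybar) = ereal c"
    by (cases "\<phi> (xbar, ybar)") auto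
  have qual: "core (eff_dom \<phi>) \<inter> gph F \<noteq> {}"
    using assms(9) by (auto simp: core_def)
  show ?thesis
  proof (intro equalityI subsetI)
    fix h assume "h \<in> subdifferential (optimal_value \<phi> F) xbar"
    from subdifferential_decompose[OF assms(1,3) qual assms(10) c this] obtain f g k
      where "linear f" "linear g" "dual_pair f g \<in> subdifferential \<phi> (xbar, ybar)"
        "k \<in> coderivative F (xbar, ybar) g" "h = (\<lambda>x. f x + k x)" .
    then show "h \<in> (\<Union>(f, g) \<in> {(f, g) \<in> algebraic_dual \<times> algebraic_dual.
                  dual_pair f g \<in> subdifferential \<phi> (xbar, ybar)}.
      (\<lambda>h x. f x + h x) ` coderivative F (xbar, ybar) g)"
      by (auto simp: algebraic_dual_def)
  next
    fix h assume "h \<in> (\<Union>(f, g) \<in> {(f, g) \<in> algebraic_dual \<times> algebraic_dual.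
                  dual_pair f g \<in> subdifferential \<phi> (xbar, ybar)}.
      (\<lambda>h x. f x + h x) ` coderivative F (xbar, ybar) g)"
    then show "h \<in> subdifferential (optimal_value \<phi> F) xbar"
      using subdifferential_compose[OF assms(10) c] by (auto simp: algebraic_dual_def)
  qed
qed

end
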